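(* For every positive integer $n$ the following identities hold: \[\lambda(4n)=\frac{(-1)^{n+1}(\pi/\sqrt{2})^{4n}}{4(4n-1)!}\sum_{m=0}^{n-1}\binom{4n-1}{4m}\mathcal{E}_{4m}^{(4,0)},\qquad \lambda(4n-2)=\frac{(-1)^{n+1}(\pi/\sqrt{2})^{4n-2}}{4(4n-3)!}\sum_{m=0}^{n-1}\binom{4n-3}{4m}\mathcal{E}_{4m}^{(4,0)},\] \[\zeta(4n)=\frac{(-1)^{n+1}(\sqrt{2}\pi)^{4n}}{4(4n-1)!(2^{4n}-1)}\sum_{m=0}^{n-1}\binom{4n-1}{4m}\mathcal{E}_{4m}^{(4,0)},\qquad \zeta(4n-2)=\frac{(-1)^{n+1}(\sqrt{2}\pi)^{4n-2}}{4(4n-3)!(2^{4n-2}-1)}\sum_{m=0}^{n-1}\binom{4n-3}{4m}\mathcal{E}_{4m}^{(4,0)},\] \[\zeta(4n)=\frac{(-1)^{n+1}(\sqrt{2}\pi)^{4n}}{4(4n+1)!}\sum_{m=0}^{n}\binom{4n+1}{4m}\mathcal{E}_{4m}^{(4,2)},\qquad \zeta(4n-2)=\frac{(-1)^{n+1}(\sqrt{2}\pi)^{4n-2}}{4(4n-1)!}\sum_{m=0}^{n-1}\binom{4n-1}{4m}\mathcal{E}_{4m}^{(4,2)},\] \[\zeta(6n)=\frac{(-1)^{n+1}(2\pi)^{6n}}{6(6n+2)!}\sum_{m=0}^{n}\binom{6n+2}{6m}\mathcal{E}_{6m}^{(6,3)},\qquad \zeta(6n-4)=\frac{(-1)^{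n+1}(2\pi)^{6n-4}}{6(6n-2)!}\sum_{m=0}^{n-1}\binom{6n-2}{6m}\mathcal{E}_{6m}^{(6,3)}.\]
   Context: $\zeta$ is the Riemann zeta function and $\lambda(s)=\sum_{k=1}^\infty (2k-1)^{-s}=(1-2^{-s})\zeta(s)$ is the Dirichlet lambda function. For integers $N\ge 1$ and $j\ge 0$, the congruential Euler numbers $\mathcal{E}_n^{(N,j)}$ ($n\ge 0$) are defined by the identity of formal power series \[\sum_{n=0}^\infty \mathcal{E}_n^{(N,j)}\frac{z^n}{n!}=\left(\sum_{n=0}^\infty \frac{z^{Nn}}{(Nn+j)!}\right)^{-1}.\] *)

theory Defs
  imports "HOL-Analysis.Analysis" "HOL-Computational_Algebra.Formal_Power_Series"
begin

text \<open>
  The Riemann zeta function and the Dirichlet lambda function, given by their Dirichlet series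
  (shifted so that the summation index starts at 0). The series converge exactly for
  \<open>Re s > 1\<close>, and only there are these definitions meaningful; no analytic continuation
  is built in.
\<close>

definition riemann_zeta :: "complex \<Rightarrow> complex" where
  "riemann_zeta s = (\<Sum>k. of_nat (Suc k) powr (-s))"

definition dirichlet_lambda :: "complex \<Rightarrow> complex" where
  "dirichlet_lambda s = (\<Sum>k. of_nat (2 * Suc k - 1) powr (-s))"

lemma summable_riemann_zeta:
  fixes s :: complex
  assumes "Re s > 1"
  shows "summable (\<lambda>k. of_nat (Suc k) powr (-s) :: complex)"
proof -
  have "summable (\<lambda>n. exp (of_real (ln (of_nat n)) * (-s)))"
    by (rule summable_complex_powr_iff) (use assms in auto)
  then have "summable (\<lambda>n. exp (of_real (ln (of_nat (Suc n))) * (-s)))"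
    by (subst summable_Suc_iff)
  moreover have "exp (of_real (ln (of_nat (Suc n))) * (-s)) = of_nat (Suc n) powr (-s)" for n
    unfolding powr_def
    by (metis Ln_of_nat mult.commute nat.distinct(1) of_nat_eq_0_iff zero_less_Suc)
  ultimately show ?thesis by simp
qed

lemma dirichlet_lambda_conv_zeta:
  assumes "Re s > 1"
  shows "dirichlet_lambda s = (1 - 2 powr (-s)) * riemann_zeta s"
proof -
  define f :: "nat \<Rightarrow> complex" where "f = (\<lambda>k. of_nat (Suc k) powr (-s))"
  have f: "f sums riemann_zeta s"
    unfolding f_def riemann_zeta_def using summable_riemann_zeta[OF assms] by (rule summable_sums)
  have "(\<lambda>n. \<Sum>i\<in>{n*2..<n*2+2}. f i) sums riemann_zeta s"
    by (rule sums_group[OF f]) auto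
  moreover have "(\<Sum>i\<in>{n*2..<n*2+2}. f i) = f (2*n) + f (2*n+1)" for n
    by (simp add: numeral_2_eq_2 mult.commute)
  ultimately have 1: "(\<lambda>n. f (2*n) + f (2*n+1)) sums riemann_zeta s" by simp
  have "f (2*n+1) = 2 powr (-s) * f n" for n
  proof -
    have "of_nat (Suc (2*n+1)) powr (-s) = (of_real 2 * of_real (real (Suc n))) powr (-s)"
      by (simp add: algebra_simps)
    also have "\<dots> = of_real 2 powr (-s) * of_real (real (Suc n)) powr (-s)"
      by (rule powr_times_real) auto
    finally show ?thesis by (simp add: f_def)
  qed
  then have "(\<lambda>n. f (2*n+1)) sums (2 powr (-s) * riemann_zeta s)"
    using sums_mult[OF f, of "2 powr (-s)"] by simp
  from sums_diff[OF 1 this]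
  have "(\<lambda>n. f (2*n)) sums ((1 - 2 powr (-s)) * riemann_zeta s)"
    by (simp add: algebra_simps)
  then show ?thesis
    unfolding dirichlet_lambda_def f_def by (simp add: sums_iff)
qed

text \<open>
  The formal power series \<open>\<Sum>n. z^(N*n) / (N*n + j)!\<close>, written by its coefficients:
  the coefficient of \<open>z^k\<close> is nonzero only for \<open>k = N * n\<close>.
\<close>

definition congr_euler_denom :: "nat \<Rightarrow> nat \<Rightarrow> real fps" where
  "congr_euler_denom N j = Abs_fps (\<lambda>k. if N dvd k then 1 / fact (k + j) else 0)"

lemma congr_euler_denom_conv_compose:
  assumes "N \<ge> 1"
  shows "congr_euler_denom N j = Abs_fps (\<lambda>n. 1 / fact (N * n + j)) oo fps_X ^ N"
proof (rule fps_ext)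
  fix k
  have "fps_nth (Abs_fps (\<lambda>n. 1 / fact (N * n + j)) oo fps_X ^ N) k =
          (\<Sum>i=0..k. if k = N * i then 1 / fact (N * i + j) else (0::real))"
    unfolding fps_compose_nth
    by (intro sum.cong) (auto simp: fps_X_power_nth simp flip: power_mult)
  also have "\<dots> = (if N dvd k then 1 / fact (k + j) else 0)"
  proof (cases "N dvd k")
    case True
    then obtain m where m: "k = N * m" by auto
    have "(\<Sum>i=0..k. if k = N * i then 1 / fact (N * i + j) else (0::real)) =
            (\<Sum>i=0..k. if i = m then 1 / fact (N * i + j) else 0)"
      using assms m by (intro sum.cong) auto
    also have "\<dots> = 1 / fact (k + j)"
      using assms m by simp
    finally show ?thesis using True by simp
  qed (auto intro!: sum.neutral)
  finally show "fps_nth (congr_euler_denom N j) k =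
      fps_nth (Abs_fps (\<lambda>n. 1 / fact (N * n + j)) oo fps_X ^ N) k"
    by (simp add: congr_euler_denom_def)
qed

text \<open>The congruential Euler number \<open>\<E>\<^sub>n\<close> with parameters \<open>N \<ge> 1\<close> and \<open>j\<close>.\<close>

definition congr_euler :: "nat \<Rightarrow> nat \<Rightarrow> nat \<Rightarrow> real" where
  "congr_euler N j n = fact n * fps_nth (inverse (congr_euler_denom N j)) n"

lemma congr_euler_egf:
  "Abs_fps (\<lambda>n. congr_euler N j n / fact n) = inverse (congr_euler_denom N j)"
  by (rule fps_ext) (simp add: congr_euler_def)

lemma congr_euler_egf_mult:
  "Abs_fps (\<lambda>n. congr_euler N j n / fact n) * congr_euler_denom N j = 1"
  unfolding congr_euler_egf by (rule inverse_mult_eq_1) (simp add: congr_euler_denom_def)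

end

theory Submission
  imports Defs "HOL-Complex_Analysis.Complex_Analysis"
begin

text \<open>
  Logarithmic differentiation of the reflection formula for the Gamma function turns the Taylor
  coefficients \<open>\<plusminus>\<zeta>(n + 1)\<close> of the Digamma function at 1 into
  \<open>z/2 * coth (z/2) = 1 - 2 * (\<Sum>k\<ge>1. \<zeta>(2k) * (z / (2 * pi * \<i>)) ^ (2k))\<close>.
  The sum over \<open>m\<close> in each identity is a coefficient of a quotient \<open>P r / P j\<close>, where \<open>P r\<close> is the
  part of the exponential series with exponents congruent to \<open>r\<close> modulo \<open>N\<close>. For the given
  \<open>(N, j)\<close> the denominator factors into terms \<open>exp (c * z) \<plusminus> 1\<close>:
  \<open>4 * exp z * P j = (exp ((1 + \<i>) * z) \<plusminus> 1) * (exp ((1 - \<i>) * z) \<plusminus> 1)\<close> if \<open>N = 4\<close>, and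
  \<open>6 * P 3\<close> is the product of \<open>exp (w * z) - 1\<close> over the cube roots of unity \<open>w\<close> if \<open>N = 6\<close>.
  Hence \<open>z * P r / P j\<close> is a linear combination of rescaled hyperbolic (co)tangents.
\<close>

section \<open>Zeta values as Taylor coefficients of the Digamma function\<close>

lemma riemann_zeta_of_nat:
  "riemann_zeta (of_nat m) = (\<Sum>k. inverse ((1 + of_nat k) ^ m))"
proof -
  have "of_nat (Suc k) powr (- of_nat m) = inverse ((1 + of_nat k :: complex) ^ m)" for k
    using powr_nat'[of "of_nat (Suc k) :: complex" m]
    by (simp add: powr_minus del: of_nat_Suc) (simp add: add.commute)
  then show ?thesis
    unfolding riemann_zeta_def by simp
qed

text \<open>Order 0 is excluded: \<open>Polygamma 0 1 = Digamma 1\<close> is minus the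
  Euler-Mascheroni constant. That term cancels later in a difference of two Digamma
  expansions.\<close>

lemma Polygamma_1_conv_zeta:
  assumes "n > 0"
  shows "Polygamma n 1 / fact n = (-1) ^ Suc n * riemann_zeta (of_nat (Suc n))"
  using assms unfolding riemann_zeta_of_nat by (simp add: Polygamma_def)

lemma one_plus_notin_nonpos_Ints:
  fixes z :: complex
  assumes "norm z < 1"
  shows "1 + z \<notin> \<int>\<^sub>\<le>\<^sub>0"
proof
  assume "1 + z \<in> \<int>\<^sub>\<le>\<^sub>0"
  then have "Re (1 + z) \<le> 0"
    by (metis complex_Re_of_int nonpos_Ints_cases of_int_0_le_iff of_int_le_0_iff)
  then show False
    using assms abs_Re_le_cmod[of z] by simp
qed

text \<open>Each differentiation contributes a factor \<open>c\<close> and raises the Polygamma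
  order by one; the bound on \<open>c\<close> keeps \<open>1 + c * z\<close> away from the poles on
  the unit disc. The cases \<open>c = 1\<close> and \<open>c = - 1\<close> are the two arguments in
  the reflection formula.\<close>

lemma higher_deriv_Digamma_linear:
  assumes "norm c \<le> 1" "norm z < 1"
  shows "(deriv ^^ n) (\<lambda>z. Digamma (1 + c * z :: complex)) z = c ^ n * Polygamma n (1 + c * z)"
  using assms(2)
proof (induction n arbitrary: z)
  case (Suc n)
  have "norm (c * z) < 1"
    using assms(1) Suc.prems by (simp add: norm_mult) (meson mult_left_le_one_le mult_le_one norm_ge_zero le_less_trans)
  then have "1 + c * z \<notin> \<int>\<^sub>\<le>\<^sub>0"
    by (rule one_plus_notin_nonpos_Ints)
  then have "((\<lambda>z. c ^ n * Polygamma n (1 + c * z)) has_field_derivative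
      c ^ Suc n * Polygamma (Suc n) (1 + c * z)) (at z)"
    by (auto intro!: derivative_eq_intros DERIV_chain2[OF has_field_derivative_Polygamma])
  \<comment> \<open>Taking one more derivative requires the induction hypothesis on a whole
    neighbourhood of \<open>z\<close>; the open disc supplies it.\<close>
  moreover have "eventually (\<lambda>z. z \<in> ball 0 1) (nhds z)"
    using Suc.prems by (intro eventually_nhds_in_open) auto
  then have "eventually (\<lambda>z. (deriv ^^ n) (\<lambda>z. Digamma (1 + c * z)) z =
      c ^ n * Polygamma n (1 + c * z)) (nhds z)"
    by eventually_elim (use Suc.IH in auto)
  ultimately show ?case
    by (simp add: DERIV_imp_deriv deriv_cong_ev)
qed simp

lemma has_fps_expansion_Digamma_linear:
  assumes "norm c \<le> 1"
  shows "(\<lambda>z. Digamma (1 + c * z :: complex)) has_fps_expansion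
    Abs_fps (\<lambda>n. c ^ n * (Polygamma n 1 / fact n))"
proof -
  have "(\<lambda>z. Digamma (1 + c * z)) holomorphic_on ball 0 1"
  proof (rule holomorphic_onI)
    fix z :: complex assume "z \<in> ball 0 1"
    then have "norm (c * z) < 1"
      using assms by (simp add: norm_mult) (meson mult_left_le_one_le mult_le_one norm_ge_zero le_less_trans)
    then have "1 + c * z \<notin> \<int>\<^sub>\<le>\<^sub>0"
      by (rule one_plus_notin_nonpos_Ints)
    then have "((\<lambda>z. Digamma (1 + c * z)) has_field_derivative c * Polygamma 1 (1 + c * z)) (at z within ball 0 1)"
      by (auto intro!: derivative_eq_intros DERIV_chain2[OF has_field_derivative_Polygamma])
    then show "(\<lambda>z. Digamma (1 + c * z)) field_differentiable at z within ball 0 1"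
      by (auto simp: field_differentiable_def)
  qed
  then have "(\<lambda>z. Digamma (1 + c * z)) has_fps_expansion
      fps_expansion (\<lambda>z. Digamma (1 + c * z)) 0"
    by (intro has_fps_expansion_fps_expansion[of "ball 0 1"]) auto
  also have "fps_expansion (\<lambda>z. Digamma (1 + c * z)) 0 =
      Abs_fps (\<lambda>n. c ^ n * (Polygamma n 1 / fact n))"
    using assms by (simp add: fps_expansion_def higher_deriv_Digamma_linear)
  finally show ?thesis .
qed

section \<open>From the reflection formula to the series of coth and tanh\<close>

lemma sin_times_Digamma_reflection:
  fixes z :: complex
  assumes "z \<notin> \<int>"
  shows "sin (of_real pi * z) * (Digamma (1 - z) - Digamma z) = of_real pi * cos (of_real pi * z)"
proof -
  have "z \<notin> \<int>\<^sub>\<le>\<^sub>0" "1 - z \<notin> \<int>\<^sub>\<le>\<^sub>0"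
    using assms by (auto simp: minus_in_Ints_iff dest!: nonpos_Ints_Int)
  then have "((\<lambda>z. rGamma z * rGamma (1 - z)) has_field_derivative
      rGamma z * rGamma (1 - z) * (Digamma (1 - z) - Digamma z)) (at z)"
    by (auto intro!: derivative_eq_intros DERIV_chain2[OF has_field_derivative_rGamma_no_nonpos_int] simp: algebra_simps)
  moreover have "((\<lambda>z. sin (of_real pi * z) / of_real pi) has_field_derivative
      cos (of_real pi * z)) (at z)"
    by (auto intro!: derivative_eq_intros)
  \<comment> \<open>The reflection formula says that the two functions just differentiated are the
    same, so their derivatives agree.\<close>
  ultimately have "sin (of_real pi * z) / of_real pi * (Digamma (1 - z) - Digamma z) = cos (of_real pi * z)"
    unfolding rGamma_reflection_complex by (rule DERIV_unique)
  then show ?thesis by (simp add: field_simps)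
qed

text \<open>Away from 0 the Digamma factor is \<open>pi * z * cot (pi * z)\<close>. Passing from
  \<open>Digamma z\<close> to \<open>Digamma (1 + z)\<close> removes the pole at 0, and multiplying
  by the denominator of cot gives an equation valid on the whole disc, 0 included.\<close>

lemma exp_times_Digamma_diff:
  fixes z :: complex
  assumes "norm z < 1"
  shows "(exp (2 * pi * \<i> * z) - 1) * (1 + z * (Digamma (1 - z) - Digamma (1 + z))) =
    pi * \<i> * z * (exp (2 * pi * \<i> * z) + 1)"
proof (cases "z = 0")
  case False
  have "z \<notin> \<int>"
    using assms False by (auto elim!: Ints_cases)
  define e where "e = exp (pi * \<i> * z)"
  have e: "e * inverse e = 1" "exp (2 * pi * \<i> * z) = e * e"
    by (auto simp: e_def mult_ac simp flip: exp_add)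
  have sc: "sin (of_real pi * z) = (e - inverse e) / (2 * \<i>)" "cos (of_real pi * z) = (e + inverse e) / 2"
    by (auto simp: sin_exp_eq cos_exp_eq e_def exp_minus mult_ac)
  have "Digamma (1 + z) = Digamma z + 1 / z"
    using Digamma_plus1[OF False] by (simp add: add.commute)
  then have "1 + z * (Digamma (1 - z) - Digamma (1 + z)) = z * (Digamma (1 - z) - Digamma z)"
    using False by (simp add: field_simps)
  moreover have "(e - inverse e) * (Digamma (1 - z) - Digamma z) = pi * \<i> * (e + inverse e)"
  proof -
    have "a * d = pi * \<i> * b" if "a / (2 * \<i>) * d = pi * (b / 2)" for a b d :: complex
    proof -
      have "a * d = a / t * d * t" if "t \<noteq> 0" for t
        using that by simp
      from this[of "2 * \<i>"] have "a * d = a / (2 * \<i>) * d * (2 * \<i>)" by simp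
      also have "\<dots> = pi * \<i> * b" unfolding that by simp
      finally show ?thesis .
    qed
    then show ?thesis
      using sin_times_Digamma_reflection[OF \<open>z \<notin> \<int>\<close>] unfolding sc by blast
  qed
  \<comment> \<open>The factor \<open>e\<close> turns \<open>e - inverse e\<close> and
    \<open>e + inverse e\<close> into \<open>exp (2 * pi * \<i> * z)\<close> minus and plus
    1.\<close>
  then have "e * z * ((e - inverse e) * (Digamma (1 - z) - Digamma z)) = e * z * (pi * \<i> * (e + inverse e))"
    by simp
  then have "(e * e - e * inverse e) * (z * (Digamma (1 - z) - Digamma z)) = pi * \<i> * z * (e * e + e * inverse e)"
    by (simp only: algebra_simps)
  ultimately show ?thesis unfolding e by simp
qed simp

text \<open>The series \<open>c * z / 2 * coth (c * z / 2)\<close>, and below \<open>c * z / 2 * tanh (c * z / 2)\<close>.\<close>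

definition coth_fps :: "complex \<Rightarrow> complex fps" where
  "coth_fps c = Abs_fps (\<lambda>n. if n = 0 then 1 else if even n
     then - 2 * riemann_zeta (of_nat n) * (c / (2 * pi * \<i>)) ^ n else 0)"

text \<open>For \<open>c = 2 * pi * \<i>\<close> the analytic identity near 0 passes to power series
  by uniqueness of expansions. Any other \<open>c\<close> is reached by rescaling the
  variable.\<close>

lemma exp_times_coth_fps:
  "(fps_exp c - 1) * coth_fps c = fps_const (c / 2) * fps_X * (fps_exp c + 1)"
proof -
  define F where "F c = Abs_fps (\<lambda>n. c ^ n * (Polygamma n 1 / fact n :: complex))" for c
  have "(\<lambda>z. (exp (2 * pi * \<i> * z) - 1) * (1 + z * (Digamma (1 + (-1) * z) - Digamma (1 + 1 * z))))
      has_fps_expansion (fps_exp (2 * pi * \<i>) - 1) * (1 + fps_X * (F (-1) - F 1))"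
    unfolding F_def
    by (intro fps_expansion_intros has_fps_expansion_Digamma_linear) auto
  moreover have "(\<lambda>z. pi * \<i> * z * (exp (2 * pi * \<i> * z) + 1)) has_fps_expansion
      fps_const (pi * \<i>) * fps_X * (fps_exp (2 * pi * \<i>) + 1)"
    by (intro fps_expansion_intros)
  moreover have "eventually (\<lambda>z::complex. z \<in> ball 0 1) (nhds 0)"
    by (intro eventually_nhds_in_open) auto
  then have "eventually (\<lambda>z. (exp (2 * pi * \<i> * z) - 1) * (1 + z * (Digamma (1 + (-1) * z) - Digamma (1 + 1 * z)))
      = pi * \<i> * z * (exp (2 * pi * \<i> * z) + 1)) (nhds 0)"
    by eventually_elim (use exp_times_Digamma_diff in auto)
  ultimately have "(fps_exp (2 * pi * \<i>) - 1) * (1 + fps_X * (F (-1) - F 1)) =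
      fps_const (pi * \<i>) * fps_X * (fps_exp (2 * pi * \<i>) + 1)"
    by (subst (asm) has_fps_expansion_cong[OF _ refl]) (auto intro: fps_expansion_unique_complex)
  \<comment> \<open>In \<open>F (-1) - F 1\<close> the coefficients of even index, among them the
    Euler-Mascheroni constant, cancel and those of odd index double. The shift by
    \<open>fps_X\<close> moves the survivors to even exponents \<open>n\<close>, each with
    coefficient \<open>- 2\<close> times zeta of \<open>n\<close>.\<close>
  also have "1 + fps_X * (F (-1) - F 1) = coth_fps (2 * pi * \<i>)"
  proof (rule fps_ext)
    fix n
    show "fps_nth (1 + fps_X * (F (-1) - F 1)) n = fps_nth (coth_fps (2 * pi * \<i>)) n"
    proof (cases "n \<ge> 2")
      case True
      then have "n = Suc (n - 1)" "n - 1 > 0" by auto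
      then obtain m where m: "n = Suc m" "m > 0" by blast
      show ?thesis
        using m Polygamma_1_conv_zeta[of m]
        by (simp add: F_def coth_fps_def)
    next
      case False
      then have "n = 0 \<or> n = 1" by auto
      then show ?thesis by (auto simp: F_def coth_fps_def)
    qed
  qed
  finally have "((fps_exp (2 * pi * \<i>) - 1) * coth_fps (2 * pi * \<i>)) oo (fps_const (c / (2 * pi * \<i>)) * fps_X) =
      (fps_const (pi * \<i>) * fps_X * (fps_exp (2 * pi * \<i>) + 1)) oo (fps_const (c / (2 * pi * \<i>)) * fps_X)"
    by simp
  moreover have "coth_fps (2 * pi * \<i>) oo (fps_const (c / (2 * pi * \<i>)) * fps_X) = coth_fps c"
    unfolding fps_compose_linear by (auto simp: coth_fps_def fps_eq_iff)
  moreover have "fps_exp (2 * pi * \<i>) oo (fps_const (c / (2 * pi * \<i>)) * fps_X) = fps_exp c"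
    unfolding fps_exp_compose_linear by simp
  ultimately show ?thesis
    by (simp add: fps_compose_mult_distrib fps_compose_add_distrib fps_compose_sub_distrib
      mult.assoc[symmetric] del: fps_exp_compose_linear)
qed

definition tanh_fps :: "complex \<Rightarrow> complex fps" where
  "tanh_fps c = coth_fps (2 * c) - coth_fps c"

text \<open>This is \<open>tanh x = 2 * coth (2 * x) - coth x\<close> with the denominators cleared.
  The coth equations for \<open>2 * c\<close> and \<open>c\<close> share the factor
  \<open>fps_exp c - 1\<close>, which is nonzero for \<open>c \<noteq> 0\<close> and can be
  cancelled.\<close>

lemma exp_times_tanh_fps:
  "(fps_exp c + 1) * tanh_fps c = fps_const (c / 2) * fps_X * (fps_exp c - 1)"
proof (cases "c = 0")
  case False
  have "fps_exp (2 * c) = fps_exp c * fps_exp c"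
    by (simp flip: fps_exp_add_mult)
  moreover have "fps_const c = 2 * fps_const (c / 2)"
    by (simp add: fps_numeral_fps_const)
  ultimately have "(fps_exp c * fps_exp c - 1) * coth_fps (2 * c) =
      2 * fps_const (c / 2) * fps_X * (fps_exp c * fps_exp c + 1)"
    using exp_times_coth_fps[of "2 * c"] by simp
  then have "(fps_exp c - 1) * ((fps_exp c + 1) * tanh_fps c) =
      (fps_exp c - 1) * (fps_const (c / 2) * fps_X * (fps_exp c - 1))"
    using exp_times_coth_fps[of c] unfolding tanh_fps_def by algebra
  then show ?thesis
    using False by simp
next
  case True
  then show ?thesis by (simp add: tanh_fps_def)
qed

lemma fps_nth_coth_fps_even:
  assumes "m > 0"
  shows "fps_nth (coth_fps c) (2 * m) =
    - 2 * (-1) ^ m * riemann_zeta (of_nat (2 * m)) * c ^ (2 * m) / (2 * pi) ^ (2 * m)"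
proof -
  have "(2 * pi * \<i>) ^ (2 * m) = (2 * pi) ^ (2 * m) * (-1) ^ m"
    by (simp add: power_mult_distrib power_mult[of \<i>])
  then have "(c / (2 * pi * \<i>)) ^ (2 * m) = (-1) ^ m * c ^ (2 * m) / (2 * pi) ^ (2 * m)"
    unfolding power_divide by (cases "even m") auto
  then show ?thesis
    using assms by (simp add: coth_fps_def)
qed

lemma dirichlet_lambda_of_nat:
  assumes "m \<ge> 2"
  shows "dirichlet_lambda (of_nat m) = (1 - 1 / 2 ^ m) * riemann_zeta (of_nat m)"
proof -
  have "(2 :: complex) powr (- of_nat m) = 1 / 2 ^ m"
    using powr_nat'[of "2 :: complex" m] by (simp add: powr_minus field_simps)
  then show ?thesis
    using assms dirichlet_lambda_conv_zeta[of "of_nat m"] by simp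
qed

text \<open>The two coth coefficients differ by a factor \<open>2 ^ (2 * m)\<close>. Their
  difference thus carries \<open>2 ^ (2 * m) - 1\<close>, which combines with the 2 in
  \<open>2 * pi\<close> to the factor relating zeta to lambda.\<close>

lemma fps_nth_tanh_fps_even:
  assumes "m > 0"
  shows "fps_nth (tanh_fps c) (2 * m) =
    - 2 * (-1) ^ m * dirichlet_lambda (of_nat (2 * m)) * c ^ (2 * m) / of_real pi ^ (2 * m)"
proof -
  have "fps_nth (tanh_fps c) (2 * m) = - 2 * (-1) ^ m * riemann_zeta (of_nat (2 * m)) * c ^ (2 * m) *
      ((2 ^ (2 * m) - 1) / (2 * pi) ^ (2 * m))"
    unfolding tanh_fps_def fps_sub_nth fps_nth_coth_fps_even[OF assms]
    by (simp add: power_mult_distrib field_simps)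
  also have "(2 ^ (2 * m) - 1) / (2 * pi) ^ (2 * m) = (1 - 1 / 2 ^ (2 * m)) / complex_of_real pi ^ (2 * m)"
    by (simp add: power_mult_distrib field_simps)
  finally show ?thesis
    using assms dirichlet_lambda_of_nat[of "2 * m"] by (simp add: mult_ac)
qed

section \<open>Sections of the exponential series and their factorisation\<close>

definition exp_section :: "nat \<Rightarrow> nat \<Rightarrow> complex fps" where
  "exp_section N r = Abs_fps (\<lambda>k. if k mod N = r then 1 / fact k else 0)"

lemma fps_nth_exp_section [simp]:
  "fps_nth (exp_section N r) k = (if k mod N = r then 1 / fact k else 0)"
  by (simp add: exp_section_def)

text \<open>Roots-of-unity filter: summing \<open>fps_exp x\<close> over the fourth roots of unity
  \<open>x\<close> with weights \<open>x ^ (4 - r)\<close> leaves the exponents congruent to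
  \<open>r\<close>.\<close>

lemma exp_section_4:
  defines "e \<equiv> fps_exp 1" and "e' \<equiv> fps_exp (- 1)" and "f \<equiv> fps_exp \<i>" and "f' \<equiv> fps_exp (- \<i>)"
  shows "e + e' + (f + f') = 4 * exp_section 4 0"
    and "e - e' - fps_const \<i> * (f - f') = 4 * exp_section 4 1"
    and "e + e' - (f + f') = 4 * exp_section 4 2"
    and "e - e' + fps_const \<i> * (f - f') = 4 * exp_section 4 3"
proof -
  have *: "(1 + (-1) ^ k + (\<i> ^ k + (- \<i>) ^ k) = (if k mod 4 = 0 then 4 else 0)) \<and>
     (1 - (-1) ^ k - \<i> * (\<i> ^ k - (- \<i>) ^ k) = (if k mod 4 = 1 then 4 else 0)) \<and>
     (1 + (-1) ^ k - (\<i> ^ k + (- \<i>) ^ k) = (if k mod 4 = 2 then 4 else 0)) \<and>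
     (1 - (-1) ^ k + \<i> * (\<i> ^ k - (- \<i>) ^ k) = (if k mod 4 = 3 then 4 else 0))" for k
  proof -
    \<comment> \<open>All four bases have fourth power 1, so only the remainder of the exponent
      counts and four cases are left.\<close>
    define q r where "q = k div 4" and "r = k mod 4"
    have k: "k = 4 * q + r" and r: "r = 0 \<or> r = 1 \<or> r = 2 \<or> r = 3"
      unfolding q_def r_def by (simp, presburger)
    have "x ^ k = x ^ r" if "x ^ 4 = 1" for x :: complex
      unfolding k power_add power_mult using that by simp
    then have eqs: "\<i> ^ k = \<i> ^ r" "(- \<i>) ^ k = (- \<i>) ^ r" "(- 1) ^ k = ((- 1) ^ r :: complex)"
      by simp_all
    show ?thesis
      unfolding eqs r_def [symmetric] using r
      by (elim disjE) (simp_all add: power2_eq_square power3_eq_cube algebra_simps)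
  qed
  have 4: "fps_nth (4 * F) k = 4 * fps_nth F k" for F :: "complex fps" and k
    by (simp add: fps_numeral_fps_const)
  show "e + e' + (f + f') = 4 * exp_section 4 0"
    using * by (simp add: fps_eq_iff 4 e_def e'_def f_def f'_def flip: add_divide_distrib diff_divide_distrib)
  show "e - e' - fps_const \<i> * (f - f') = 4 * exp_section 4 1"
    using * by (simp add: fps_eq_iff 4 e_def e'_def f_def f'_def flip: add_divide_distrib diff_divide_distrib)
  show "e + e' - (f + f') = 4 * exp_section 4 2"
    using * by (simp add: fps_eq_iff 4 e_def e'_def f_def f'_def flip: add_divide_distrib diff_divide_distrib)
  show "e - e' + fps_const \<i> * (f - f') = 4 * exp_section 4 3"
    using * by (simp add: fps_eq_iff 4 e_def e'_def f_def f'_def flip: add_divide_distrib diff_divide_distrib)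
qed

text \<open>The same filter over the sixth roots of unity, which are plus and minus
  \<open>1\<close>, \<open>z\<close> and \<open>z\<^sup>2\<close>. Residue 3 supplies the
  denominator, residues 2 and 4 the numerators.\<close>

lemma exp_section_6:
  fixes z :: complex
  assumes z: "z\<^sup>2 + z + 1 = 0"
  defines "u \<equiv> fps_exp 1" and "u' \<equiv> fps_exp (- 1)" and "v \<equiv> fps_exp z" and "v' \<equiv> fps_exp (- z)"
    and "w \<equiv> fps_exp (z\<^sup>2)" and "w' \<equiv> fps_exp (- (z\<^sup>2))"
  shows "u + u' + fps_const z * (v + v') + fps_const (z\<^sup>2) * (w + w') = 6 * exp_section 6 2"
    and "u - u' + (v - v') + (w - w') = 6 * exp_section 6 3"
    and "u + u' + fps_const (z\<^sup>2) * (v + v') + fps_const z * (w + w') = 6 * exp_section 6 4"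
proof -
  have z2: "z\<^sup>2 = - 1 - z" using z by algebra
  have z3: "z ^ 3 = 1" using z by algebra
  then have z6: "z ^ 6 = 1" using power_mult[of z 3 2] by simp
  \<comment> \<open>As rewrite rules these reduce every polynomial in \<open>z\<close> to degree at
    most 1; the second one handles products nested to the right.\<close>
  have zz: "z * z = - 1 - z" "z * (z * x) = (- 1 - z) * x" for x
    using z2 by (simp_all add: power2_eq_square flip: mult.assoc)
  have *: "(1 + (-1) ^ k + z * (z ^ k + (- z) ^ k) + z\<^sup>2 * ((z\<^sup>2) ^ k + (- (z\<^sup>2)) ^ k) = (if k mod 6 = 2 then 6 else 0)) \<and>
     (1 - (-1) ^ k + (z ^ k - (- z) ^ k) + ((z\<^sup>2) ^ k - (- (z\<^sup>2)) ^ k) = (if k mod 6 = 3 then 6 else 0)) \<and>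
     (1 + (-1) ^ k + z\<^sup>2 * (z ^ k + (- z) ^ k) + z * ((z\<^sup>2) ^ k + (- (z\<^sup>2)) ^ k) = (if k mod 6 = 4 then 6 else 0))" for k
  proof -
    define q r where "q = k div 6" and "r = k mod 6"
    have "k = 6 * q + r" and r: "r = 0 \<or> r = 1 \<or> r = 2 \<or> r = 3 \<or> r = 4 \<or> r = 5"
      unfolding q_def r_def by (simp, presburger)
    have "z ^ k = (z ^ 6) ^ q * z ^ r"
      by (simp only: \<open>k = 6 * q + r\<close> power_add power_mult)
    moreover have "(-1) ^ k = (((-1) ^ 6) ^ q * (-1) ^ r :: complex)"
      by (simp only: \<open>k = 6 * q + r\<close> power_add power_mult)
    moreover have "(z\<^sup>2) ^ k = (z ^ k)\<^sup>2"
      by (simp only: power_mult [symmetric] mult.commute)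
    ultimately have "z ^ k = z ^ r" "(z\<^sup>2) ^ k = (z ^ r)\<^sup>2" "(-1) ^ k = ((-1) ^ r :: complex)"
      using z6 by simp_all
    then have "z ^ k = z ^ r" "(z\<^sup>2) ^ k = (z ^ r)\<^sup>2" "(-1) ^ k = ((-1) ^ r :: complex)"
      "(- z) ^ k = (-1) ^ r * z ^ r" "(- (z\<^sup>2)) ^ k = (-1) ^ r * (z ^ r)\<^sup>2" 
      by (simp_all add: power_minus[of z k] power_minus[of "z\<^sup>2" k])
    note eqs = this
    have z5: "z ^ 5 = z * z * z * z * z"
      by (simp add: eval_nat_numeral)
    show ?thesis
      unfolding eqs r_def [symmetric] using r
      by (elim disjE) (simp_all add: z5 power2_eq_square power3_eq_cube power4_eq_xxxx zz algebra_simps)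
  qed
  have 6: "fps_nth (6 * F) k = 6 * fps_nth F k" for F :: "complex fps" and k
    by (simp add: fps_numeral_fps_const)
  show "u + u' + fps_const z * (v + v') + fps_const (z\<^sup>2) * (w + w') = 6 * exp_section 6 2"
    using * by (simp add: fps_eq_iff 6 u_def u'_def v_def v'_def w_def w'_def
        flip: add_divide_distrib diff_divide_distrib)
  show "u - u' + (v - v') + (w - w') = 6 * exp_section 6 3"
    using * by (simp add: fps_eq_iff 6 u_def u'_def v_def v'_def w_def w'_def
        flip: add_divide_distrib diff_divide_distrib)
  show "u + u' + fps_const (z\<^sup>2) * (v + v') + fps_const z * (w + w') = 6 * exp_section 6 4"
    using * by (simp add: fps_eq_iff 6 u_def u'_def v_def v'_def w_def w'_def
        flip: add_divide_distrib diff_divide_distrib)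
qed

text \<open>Here \<open>e\<close>, \<open>e'\<close>, \<open>f\<close>, \<open>f'\<close> stand for
  the exponentials of \<open>z\<close>, \<open>-z\<close>, \<open>\<i> * z\<close>,
  \<open>- \<i> * z\<close>, and \<open>J\<close> for \<open>\<i>\<close>. The sign
  \<open>s = 1\<close> is the coth case and \<open>s = - 1\<close> the tanh case. The denominator,
  times the unit \<open>e\<close>, splits into \<open>(e * f - s) * (e * f' - s)\<close>, so a
  combination of \<open>K\<close> and \<open>K'\<close> can be put over it. The factors 2 avoid the
  halves in \<open>(1 + J) / 2\<close>.\<close>

lemma quartic_identity:
  fixes e e' f f' J K K' X s :: "'a :: idom"
  assumes ee: "e * e' = 1" and ff: "f * f' = 1" and J: "J * J = - 1" and s: "s * s = 1"
    and K: "2 * ((e * f - s) * K) = (1 + J) * X * (e * f + s)"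
    and K': "2 * ((e * f' - s) * K') = (1 - J) * X * (e * f' + s)"
  shows "2 * ((e + e' - s * (f + f')) * (K + K')) = 2 * (X * (e - e' - s * J * (f - f')))"
    and "2 * ((e + e' - s * (f + f')) * (J * (K' - K))) = 2 * (X * (e - e' + s * J * (f - f')))"
proof -
  have *: "(e * f - s) * (e * f' - s) = e * (e + e' - s * (f + f'))"
    using ee ff s by algebra
  have "e * (2 * ((e + e' - s * (f + f')) * (a * K + b * K'))) =
      e * (X * (a * (1 + J) * (e - e' - s * (f - f')) + b * (1 - J) * (e - e' + s * (f - f'))))" for a b
  proof -
    have "e * (2 * ((e + e' - s * (f + f')) * (a * K + b * K'))) =
        a * (e * f' - s) * (2 * ((e * f - s) * K)) + b * (e * f - s) * (2 * ((e * f' - s) * K'))"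
      using * by algebra
    also have "\<dots> = X * (a * (1 + J) * ((e * f + s) * (e * f' - s)) + b * (1 - J) * ((e * f - s) * (e * f' + s)))"
      unfolding K K' by algebra
    also have "(e * f + s) * (e * f' - s) = e * (e - e' - s * (f - f'))"
      using ee ff s by algebra
    also have "(e * f - s) * (e * f' + s) = e * (e - e' + s * (f - f'))"
      using ee ff s by algebra
    finally show ?thesis by algebra
  qed
  moreover have "e \<noteq> 0" using ee by auto
  ultimately have **: "2 * ((e + e' - s * (f + f')) * (a * K + b * K')) =
      X * (a * (1 + J) * (e - e' - s * (f - f')) + b * (1 - J) * (e - e' + s * (f - f')))" for a b
    by simp
  show "2 * ((e + e' - s * (f + f')) * (K + K')) = 2 * (X * (e - e' - s * J * (f - f')))"
    using **[of 1 1] by algebra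
  show "2 * ((e + e' - s * (f + f')) * (J * (K' - K))) = 2 * (X * (e - e' + s * J * (f - f')))"
    \<comment> \<open>\<open>- J * (1 + J) = 1 - J\<close> and \<open>J * (1 - J) = 1 + J\<close>,
      so these weights interchange the two factors of the case \<open>a = b = 1\<close> and reverse
      the sign of the \<open>J\<close> term.\<close>
    using **[of "- J" J] J by algebra
qed

text \<open>Here \<open>u\<close>, \<open>v\<close>, \<open>w\<close> stand for the exponentials
  along the three cube roots of unity. Those roots sum to 0, whence \<open>u * v * w = 1\<close>,
  and this factors the denominator as \<open>(u - 1) * (v - 1) * (w - 1)\<close>.\<close>

lemma sextic_identity:
  fixes u u' v v' w w' K0 K1 K2 X a b c z :: "'a :: idom"
  assumes u: "u * u' = 1" and v: "v * v' = 1" and w: "w * w' = 1" and uvw: "u * v * w = 1"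
    and abc: "a + b * z + c * z\<^sup>2 = 0"
    and K0: "2 * ((u - 1) * K0) = X * (u + 1)"
    and K1: "2 * ((v - 1) * K1) = z * X * (v + 1)"
    and K2: "2 * ((w - 1) * K2) = z\<^sup>2 * X * (w + 1)"
  shows "2 * ((u - u' + (v - v') + (w - w')) * (a * K0 + b * K1 + c * K2)) =
    2 * (X * (a * (u + u') + b * z * (v + v') + c * z\<^sup>2 * (w + w')))"
proof -
  have inv: "u' = v * w" "v' = u * w" "w' = u * v"
    using u v w uvw by algebra+
  have "u - u' + (v - v') + (w - w') = (u - 1) * (v - 1) * (w - 1)"
    using uvw unfolding inv by algebra
  then have "2 * ((u - u' + (v - v') + (w - w')) * (a * K0 + b * K1 + c * K2)) =
      a * (v - 1) * (w - 1) * (2 * ((u - 1) * K0)) + b * (u - 1) * (w - 1) * (2 * ((v - 1) * K1)) +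
      c * (u - 1) * (v - 1) * (2 * ((w - 1) * K2))"
    by algebra
  also have "\<dots> = X * (a * ((u + 1) * (v - 1) * (w - 1)) + b * z * ((u - 1) * (v + 1) * (w - 1)) +
      c * z\<^sup>2 * ((u - 1) * (v - 1) * (w + 1)))"
    unfolding K0 K1 K2 by algebra
  also have "\<dots> = 2 * (X * (a * (u + u') + b * z * (v + v') + c * z\<^sup>2 * (w + w')))"
  proof -
    \<comment> \<open>The three numerators leave one and the same symmetric remainder
      \<open>S\<close>, whose total weight \<open>a + b * z + c * z\<^sup>2\<close>
      vanishes.\<close>
    define S where "S = 2 - (u + u' + (v + v') + (w + w'))"
    have "(u + 1) * (v - 1) * (w - 1) = 2 * (u + u') + S"
      "(u - 1) * (v + 1) * (w - 1) = 2 * (v + v') + S"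
      "(u - 1) * (v - 1) * (w + 1) = 2 * (w + w') + S"
      using uvw unfolding inv S_def by algebra+
    then show ?thesis using abc by algebra
  qed
  finally show ?thesis .
qed

section \<open>Quotients of sections: their coefficients and closed forms\<close>

text \<open>
  The series \<open>P j = z ^ j * congr_euler_denom N j\<close> is not invertible for \<open>j > 0\<close>, so the quotient
  \<open>A = z * P r / P j\<close> is given by the equation that characterises it.
\<close>

lemma congr_euler_sum:
  assumes N: "N > 0" "j < N" "r < N"
    and A: "exp_section N j * A = fps_X * exp_section N r"
    and k: "k = N * M + r" "i + j = Suc k"
  shows "complex_of_real (\<Sum>m=0..M. real (k choose (N * m)) * congr_euler N j (N * m)) = fact k * fps_nth A i"
proof -
  define E where "E = Abs_fps (\<lambda>n. complex_of_real (congr_euler N j n / fact n))"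
  define D where "D = Abs_fps (\<lambda>n. complex_of_real (fps_nth (congr_euler_denom N j) n))"
  have "E * D = 1"
  proof (rule fps_ext)
    fix n
    have "fps_nth (E * D) n = of_real (fps_nth (Abs_fps (\<lambda>n. congr_euler N j n / fact n) * congr_euler_denom N j) n)"
      by (simp add: E_def D_def fps_mult_nth)
    then show "fps_nth (E * D) n = fps_nth 1 n"
      unfolding congr_euler_egf_mult by simp
  qed
  moreover have "exp_section N j = fps_X ^ j * D"
  proof (rule fps_ext)
    fix n
    have "n mod N = j \<longleftrightarrow> j \<le> n \<and> N dvd n - j"
      using N by (metis dvd_minus_mod le_add_diff_inverse mod_eq_dvd_iff_nat mod_less mod_less_eq_dividend)
    then show "fps_nth (exp_section N j) n = fps_nth (fps_X ^ j * D) n"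
      by (auto simp: fps_X_power_mult_nth D_def congr_euler_denom_def)
  qed
  \<comment> \<open>Multiplying the equation for \<open>A\<close> by \<open>E\<close> cancels
    \<open>D\<close> and leaves only the power \<open>fps_X ^ j\<close> of the denominator.\<close>
  ultimately have "fps_X ^ j * A = fps_X * (E * exp_section N r)"
    by (metis A mult.assoc mult.commute mult.left_commute mult_1)
  \<comment> \<open>The factor \<open>fps_X\<close> on the right is why the coefficient
    \<open>Suc k\<close> is taken; on the left it is coefficient \<open>i\<close> of
    \<open>A\<close>, since \<open>i + j = Suc k\<close>.\<close>
  then have "fps_nth (fps_X ^ j * A) (Suc k) = fps_nth (E * exp_section N r) k"
    by simp
  then have "fact k * fps_nth A i = fact k * fps_nth (E * exp_section N r) k"
    by (simp add: fps_X_power_mult_nth k(2) [symmetric])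
  also have "\<dots> = (\<Sum>m=0..k. if N dvd m then of_real (real (k choose m) * congr_euler N j m) else 0)"
    unfolding fps_mult_nth sum_distrib_left
  proof (rule sum.cong)
    fix m assume "m \<in> {0..k}"
    then have m: "m \<le> k" by simp
    \<comment> \<open>Since \<open>k\<close> itself has residue \<open>r\<close>, asking
      \<open>k - m\<close> for residue \<open>r\<close> selects exactly the multiples of
      \<open>N\<close>.\<close>
    have "(k - m) mod N = r \<longleftrightarrow> N dvd m"
    proof -
      have "(k - m) mod N = r \<longleftrightarrow> (k - m) mod N = k mod N"
        using N k by simp
      also have "\<dots> \<longleftrightarrow> N dvd m"
        using m mod_eq_dvd_iff_nat[of "k - m" k N] by auto
      finally show ?thesis .
    qed

    then show "fact k * (fps_nth E m * fps_nth (exp_section N r) (k - m)) =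
        (if N dvd m then of_real (real (k choose m) * congr_euler N j m) else 0)"
      using m binomial_fact[OF m, where ?'a = complex] by (simp add: E_def)
  qed simp
  also have "\<dots> = (\<Sum>m\<in>{m\<in>{0..k}. N dvd m}. of_real (real (k choose m) * congr_euler N j m))"
    by (rule sum.inter_filter [symmetric]) simp
  also have "{m\<in>{0..k}. N dvd m} = (\<lambda>m. N * m) ` {0..M}"
  proof -
    have *: "N * m \<le> k \<longleftrightarrow> m \<le> M" for m
    proof -
      have "N * m \<le> k \<longleftrightarrow> m \<le> k div N"
        using N by (simp add: less_eq_div_iff_mult_less_eq mult.commute)
      then show ?thesis using N k by simp
    qed
    show ?thesis
    proof (intro equalityI subsetI)
      fix x assume "x \<in> {m\<in>{0..k}. N dvd m}"
      then obtain q where "x = N * q" "N * q \<le> k"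
        unfolding dvd_def by auto
      then show "x \<in> (\<lambda>m. N * m) ` {0..M}"
        unfolding * by (intro image_eqI[of _ _ q]) simp_all
    next
      fix x assume "x \<in> (\<lambda>m. N * m) ` {0..M}"
      then obtain q where "x = N * q" "q \<le> M"
        by (metis atLeastAtMost_iff imageE)
      then show "x \<in> {m\<in>{0..k}. N dvd m}"
        using *[of q] by simp
    qed
  qed
  also have "(\<Sum>m\<in>(\<lambda>m. N * m) ` {0..M}. complex_of_real (real (k choose m) * congr_euler N j m)) =
      complex_of_real (\<Sum>m=0..M. real (k choose (N * m)) * congr_euler N j (N * m))"
    using N by (subst sum.reindex) (auto simp: inj_on_def)
  finally show ?thesis by simp
qed

text \<open>In even degree \<open>n\<close>, \<open>(1 + \<i>) ^ n\<close> and
  \<open>(1 - \<i>) ^ n\<close> agree if 4 divides \<open>n\<close> and are opposite otherwise. The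
  sums therefore yield the arguments \<open>4 * n\<close>, the differences the arguments
  \<open>4 * n - 2\<close>.\<close>

lemma exp_section_4_coth_fps:
  "exp_section 4 2 * (coth_fps (1 + \<i>) + coth_fps (1 - \<i>)) = fps_X * exp_section 4 1"
  "exp_section 4 2 * (fps_const \<i> * (coth_fps (1 - \<i>) - coth_fps (1 + \<i>))) = fps_X * exp_section 4 3"
  and exp_section_4_tanh_fps:
  "exp_section 4 0 * (tanh_fps (1 + \<i>) + tanh_fps (1 - \<i>)) = fps_X * exp_section 4 3"
  "exp_section 4 0 * (fps_const \<i> * (tanh_fps (1 - \<i>) - tanh_fps (1 + \<i>))) = fps_X * exp_section 4 1"
proof -
  define J where "J = fps_const \<i>"
  define e e' f f' where "e = fps_exp (1 :: complex)" and "e' = fps_exp (- 1 :: complex)"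
    and "f = fps_exp \<i>" and "f' = fps_exp (- \<i>)"
  have inv: "e * e' = 1" "f * f' = 1" "J * J = - 1"
    by (simp_all add: e_def e'_def f_def f'_def J_def flip: fps_exp_add_mult)
  have ef: "fps_exp (1 + \<i>) = e * f" "fps_exp (1 - \<i>) = e * f'"
    by (simp_all add: e_def f_def f'_def flip: fps_exp_add_mult)
  have half: "2 * fps_const ((1 + \<i>) / 2) = 1 + J" "2 * fps_const ((1 - \<i>) / 2) = 1 - J"
    by (simp_all add: J_def fps_numeral_fps_const flip: fps_const_1_eq_1)
  have coth: "2 * ((e * f - 1) * coth_fps (1 + \<i>)) = (1 + J) * fps_X * (e * f + 1)"
    "2 * ((e * f' - 1) * coth_fps (1 - \<i>)) = (1 - J) * fps_X * (e * f' + 1)"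
    using exp_times_coth_fps[of "1 + \<i>"] exp_times_coth_fps[of "1 - \<i>"]
    by (simp_all add: ef mult.assoc flip: half)
  have tanh: "2 * ((e * f - (- 1)) * tanh_fps (1 + \<i>)) = (1 + J) * fps_X * (e * f + (- 1))"
    "2 * ((e * f' - (- 1)) * tanh_fps (1 - \<i>)) = (1 - J) * fps_X * (e * f' + (- 1))"
    using exp_times_tanh_fps[of "1 + \<i>"] exp_times_tanh_fps[of "1 - \<i>"]
    by (simp_all add: ef mult.assoc flip: half)
  have sgn: "x - (- 1) * y = x + y" "x - (- 1) * J * y = x + J * y" "x + (- 1) * J * y = x - J * y" for x y
    by simp_all
  note sec = exp_section_4[folded e_def e'_def f_def f'_def J_def]
  have cancel: "p * k = x * q" if "2 * (4 * p * k) = 2 * (x * (4 * q))" for p q k x :: "complex fps"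
    using that by (simp add: mult.assoc mult.left_commute[of x])
  show "exp_section 4 2 * (coth_fps (1 + \<i>) + coth_fps (1 - \<i>)) = fps_X * exp_section 4 1"
    by (rule cancel, use quartic_identity(1)[OF inv _ coth] in \<open>simp add: sec\<close>)
  show "exp_section 4 2 * (fps_const \<i> * (coth_fps (1 - \<i>) - coth_fps (1 + \<i>))) = fps_X * exp_section 4 3"
    unfolding J_def [symmetric]
    by (rule cancel, use quartic_identity(2)[OF inv _ coth] in \<open>simp add: sec\<close>)
  show "exp_section 4 0 * (tanh_fps (1 + \<i>) + tanh_fps (1 - \<i>)) = fps_X * exp_section 4 3"
    by (rule cancel, use quartic_identity(1)[OF inv _ tanh, unfolded sgn sec] in simp)
  show "exp_section 4 0 * (fps_const \<i> * (tanh_fps (1 - \<i>) - tanh_fps (1 + \<i>))) = fps_X * exp_section 4 1"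
    unfolding J_def [symmetric]
    by (rule cancel, use quartic_identity(2)[OF inv _ tanh, unfolded sgn sec] in simp)
qed

text \<open>Weights \<open>1, 1, 1\<close> keep the even degrees divisible by 6; weights
  \<open>1, z, z\<^sup>2\<close> keep those congruent to 2 modulo 6. Both satisfy the weight
  condition of \<open>sextic_identity\<close>.\<close>

lemma exp_section_6_coth_fps:
  assumes z: "z\<^sup>2 + z + 1 = 0"
  shows "exp_section 6 3 * (coth_fps 1 + coth_fps z + coth_fps (z\<^sup>2)) = fps_X * exp_section 6 2"
    and "exp_section 6 3 * (coth_fps 1 + fps_const z * coth_fps z + fps_const (z\<^sup>2) * coth_fps (z\<^sup>2)) =
      fps_X * exp_section 6 4"
proof -
  define Z where "Z = fps_const z"
  define u u' v v' w w' where "u = fps_exp (1 :: complex)" and "u' = fps_exp (- 1 :: complex)"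
    and "v = fps_exp z" and "v' = fps_exp (- z)" and "w = fps_exp (z\<^sup>2)" and "w' = fps_exp (- (z\<^sup>2))"
  have "1 + z + z\<^sup>2 = 0" using z by algebra
  then have inv: "u * u' = 1" "v * v' = 1" "w * w' = 1" "u * v * w = 1"
    by (simp_all add: u_def u'_def v_def v'_def w_def w'_def flip: fps_exp_add_mult)
  have Z2: "fps_const (z\<^sup>2) = Z\<^sup>2"
    by (simp add: Z_def)
  have "fps_const (1 + z + z\<^sup>2) = 1 + Z + Z\<^sup>2"
    by (simp add: Z_def flip: fps_const_1_eq_1)
  then have Z: "1 + Z + Z\<^sup>2 = 0"
    unfolding \<open>1 + z + z\<^sup>2 = 0\<close> by simp
  have half: "2 * fps_const (1 / 2 :: complex) = 1" "2 * fps_const (z / 2) = Z" "2 * fps_const (z\<^sup>2 / 2) = Z\<^sup>2"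
    by (simp_all add: Z_def fps_numeral_fps_const)
  have coth: "2 * ((u - 1) * coth_fps 1) = fps_X * (u + 1)"
    "2 * ((v - 1) * coth_fps z) = Z * fps_X * (v + 1)"
    "2 * ((w - 1) * coth_fps (z\<^sup>2)) = Z\<^sup>2 * fps_X * (w + 1)"
    using exp_times_coth_fps[of 1] exp_times_coth_fps[of z] exp_times_coth_fps[of "z\<^sup>2"] half
    by (simp_all add: u_def v_def w_def flip: mult.assoc)
  note sec = exp_section_6[OF z, folded u_def u'_def v_def v'_def w_def w'_def Z_def, unfolded Z2]
  have cancel: "p * k = x * q" if "2 * (6 * p * k) = 2 * (x * (6 * q))" for p q k x :: "complex fps"
    using that by (simp add: mult.assoc mult.left_commute[of x])
  have "1 + 1 * Z + 1 * Z\<^sup>2 = 0" using Z by simp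
  from sextic_identity[OF inv this coth, unfolded mult_1 sec]
  show "exp_section 6 3 * (coth_fps 1 + coth_fps z + coth_fps (z\<^sup>2)) = fps_X * exp_section 6 2"
    by (rule cancel)
  \<comment> \<open>The weights multiply the factors \<open>Z\<close> and \<open>Z\<^sup>2\<close>
    already present; reduced by \<open>Z ^ 3 = 1\<close>, the products are the filter weights of
    residue 4.\<close>
  have Z4: "Z * Z = Z\<^sup>2" "Z\<^sup>2 * Z\<^sup>2 = Z"
    using Z by (simp add: power2_eq_square, algebra)
  have "1 + Z * Z + Z\<^sup>2 * Z\<^sup>2 = 0"
    using Z by algebra
  from sextic_identity[OF inv this coth, unfolded mult_1 Z4 sec]
  show "exp_section 6 3 * (coth_fps 1 + fps_const z * coth_fps z + fps_const (z\<^sup>2) * coth_fps (z\<^sup>2)) =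
      fps_X * exp_section 6 4"
    unfolding Z2 Z_def [symmetric] by (rule cancel)
qed

section \<open>Powers of \<open>1 + \<i>\<close> and \<open>sqrt 2\<close>, and the final
  rearrangement\<close>

lemma one_plus_i_powers:
  fixes n :: nat
  shows "(1 + \<i>) ^ (4 * n) + (1 - \<i>) ^ (4 * n) = 2 * (- 1) ^ n * 4 ^ n"
    and "n \<ge> 1 \<Longrightarrow> \<i> * ((1 - \<i>) ^ (4 * n - 2) - (1 + \<i>) ^ (4 * n - 2)) = - ((- 1) ^ n * 4 ^ n)"
proof -
  \<comment> \<open>Both fourth powers are equal to \<open>- 4\<close>.\<close>
  have *: "(1 + \<i>) ^ (4 * m) = (- 1) ^ m * 4 ^ m" "(1 - \<i>) ^ (4 * m) = (- 1) ^ m * 4 ^ m" for m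
    unfolding power_mult power_mult_distrib [symmetric]
    by (simp_all add: power4_eq_xxxx algebra_simps)
  then show "(1 + \<i>) ^ (4 * n) + (1 - \<i>) ^ (4 * n) = 2 * (- 1) ^ n * 4 ^ n"
    by simp
  assume "n \<ge> 1"
  then obtain m where n: "n = Suc m" by (cases n) auto
  have "4 * n - 2 = 4 * m + 2" using n by simp
  have "\<i> * ((1 - \<i>) ^ (4 * n - 2) - (1 + \<i>) ^ (4 * n - 2)) = (- 1) ^ m * 4 ^ m * (\<i> * ((1 - \<i>)\<^sup>2 - (1 + \<i>)\<^sup>2))"
    unfolding \<open>4 * n - 2 = 4 * m + 2\<close> power_add * by (simp add: algebra_simps)
  also have "\<i> * ((1 - \<i>)\<^sup>2 - (1 + \<i>)\<^sup>2) = 4"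
    by (simp add: power2_eq_square algebra_simps)
  finally show "\<i> * ((1 - \<i>) ^ (4 * n - 2) - (1 + \<i>) ^ (4 * n - 2)) = - ((- 1) ^ n * 4 ^ n)"
    using n by simp
qed

text \<open>The common last move: \<open>Z\<close> is the zeta or lambda value, \<open>Q\<close> the
  power of pi and \<open>a\<close> the constant 4 or 6. The sign changes sides because it is its own
  inverse.\<close>

lemma of_real_solve_sign:
  assumes "complex_of_real S = fact k * (- of_real a * (- 1) ^ n * Z / of_real Q)" "a \<noteq> 0" "Q \<noteq> 0"
  shows "Z = of_real ((- 1) ^ (n + 1) * Q / (a * fact k) * S)"
proof -
  have "(- 1) ^ n * (- 1) ^ n = (1 :: complex)"
    by (simp flip: power_mult_distrib)
  then have "complex_of_real ((- 1) ^ (n + 1) * Q / (a * fact k) * S) = (- 1) ^ n * (- 1) ^ n * Z"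
    using assms(2,3) unfolding of_real_mult assms(1) by (simp add: field_simps)
  then show ?thesis
    using \<open>(- 1) ^ n * (- 1) ^ n = (1 :: complex)\<close> by simp
qed

text \<open>These absorb the \<open>4 ^ n\<close> from the powers of \<open>1 + \<i>\<close>,
  changing \<open>pi\<close> to \<open>pi / sqrt 2\<close> and \<open>2 * pi\<close> to
  \<open>sqrt 2 * pi\<close>.\<close>

lemma sqrt_2_powers:
  shows "sqrt 2 ^ (4 * n) = 4 ^ n" and "n \<ge> 1 \<Longrightarrow> sqrt 2 ^ (4 * n - 2) = 4 ^ n / 2"
proof -
  have "sqrt 2 ^ 4 = 4"
    using power_mult[of "sqrt 2" 2 2] by simp
  then show *: "sqrt 2 ^ (4 * n) = 4 ^ n" for n
    by (simp add: power_mult)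
  assume "n \<ge> 1"
  then obtain m where n: "n = Suc m" by (cases n) auto
  have m: "4 * n - 2 = 4 * m + 2" using n by simp
  show "sqrt 2 ^ (4 * n - 2) = 4 ^ n / 2"
    unfolding m power_add * using n by simp
qed

lemma two_pi_power: "(2 * pi) ^ k = sqrt 2 ^ k * (sqrt 2 * pi) ^ k"
proof -
  have "2 * pi = sqrt 2 * (sqrt 2 * pi)"
    by (simp flip: mult.assoc)
  then show ?thesis
    by (metis power_mult_distrib)
qed

section \<open>The identities, one coefficient comparison each\<close>

lemma dirichlet_lambda_4:
  assumes "n \<ge> 1"
  shows "dirichlet_lambda (of_nat (4 * n)) = complex_of_real
    ((-1) ^ (n + 1) * (pi / sqrt 2) ^ (4 * n) / (4 * fact (4 * n - 1)) *
      (\<Sum>m = 0..n - 1. real ((4 * n - 1) choose (4 * m)) * congr_euler 4 0 (4 * m)))"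
proof (rule of_real_solve_sign)
  have 2: "4 * n = 2 * (2 * n)" "(- 1) ^ (2 * n) = (1 :: complex)" "2 * n > 0"
    using assms by auto
  have "fps_nth (tanh_fps (1 + \<i>) + tanh_fps (1 - \<i>)) (4 * n) =
      - 2 * dirichlet_lambda (of_nat (4 * n)) * ((1 + \<i>) ^ (4 * n) + (1 - \<i>) ^ (4 * n)) / of_real pi ^ (4 * n)"
    unfolding fps_add_nth 2(1) fps_nth_tanh_fps_even[OF 2(3)] 2(2) by (simp add: algebra_simps add_divide_distrib diff_divide_distrib)
  also have "\<dots> = - of_real 4 * (- 1) ^ n * dirichlet_lambda (of_nat (4 * n)) / of_real ((pi / sqrt 2) ^ (4 * n))"
  proof -
    have "(pi / sqrt 2) ^ (4 * n) = pi ^ (4 * n) / 4 ^ n"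
      by (simp add: power_divide sqrt_2_powers)
    then show ?thesis
      unfolding one_plus_i_powers(1) by simp
  qed
  finally show "complex_of_real (\<Sum>m = 0..n - 1. real ((4 * n - 1) choose (4 * m)) * congr_euler 4 0 (4 * m)) =
      fact (4 * n - 1) * (- of_real 4 * (- 1) ^ n * dirichlet_lambda (of_nat (4 * n)) / of_real ((pi / sqrt 2) ^ (4 * n)))"
    \<comment> \<open>\<open>j = 0\<close>, \<open>r = 3\<close> and
      \<open>k = 4 * n - 1 = 4 * (n - 1) + 3\<close>.\<close>
    using assms by (subst congr_euler_sum[OF _ _ _ exp_section_4_tanh_fps(1), where i = "4 * n"]) auto
qed auto

lemma dirichlet_lambda_4_minus_2:
  assumes "n \<ge> 1"
  shows "dirichlet_lambda (of_nat (4 * n - 2)) = complex_of_real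
    ((-1) ^ (n + 1) * (pi / sqrt 2) ^ (4 * n - 2) / (4 * fact (4 * n - 3)) *
      (\<Sum>m = 0..n - 1. real ((4 * n - 3) choose (4 * m)) * congr_euler 4 0 (4 * m)))"
proof (rule of_real_solve_sign)
  have 2: "4 * n - 2 = 2 * (2 * n - 1)" "(- 1) ^ (2 * n - 1) = (- 1 :: complex)" "2 * n - 1 > 0"
    using assms by (auto simp: power_minus_odd)
  have "fps_nth (fps_const \<i> * (tanh_fps (1 - \<i>) - tanh_fps (1 + \<i>))) (4 * n - 2) =
      2 * dirichlet_lambda (of_nat (4 * n - 2)) * (\<i> * ((1 - \<i>) ^ (4 * n - 2) - (1 + \<i>) ^ (4 * n - 2)))
        / of_real pi ^ (4 * n - 2)"
    unfolding fps_mult_left_const_nth fps_sub_nth 2(1) fps_nth_tanh_fps_even[OF 2(3)] 2(2)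
    by (simp add: field_simps)
  also have "\<dots> = - of_real 4 * (- 1) ^ n * dirichlet_lambda (of_nat (4 * n - 2)) / of_real ((pi / sqrt 2) ^ (4 * n - 2))"
  proof -
    have "(pi / sqrt 2) ^ (4 * n - 2) = pi ^ (4 * n - 2) / (4 ^ n / 2)"
      by (simp only: power_divide sqrt_2_powers(2)[OF assms])
    then show ?thesis
      unfolding one_plus_i_powers(2)[OF assms] by simp
  qed
  finally show "complex_of_real (\<Sum>m = 0..n - 1. real ((4 * n - 3) choose (4 * m)) * congr_euler 4 0 (4 * m)) =
      fact (4 * n - 3) * (- of_real 4 * (- 1) ^ n * dirichlet_lambda (of_nat (4 * n - 2)) / of_real ((pi / sqrt 2) ^ (4 * n - 2)))"
    \<comment> \<open>\<open>j = 0\<close>, \<open>r = 1\<close> and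
      \<open>k = 4 * n - 3 = 4 * (n - 1) + 1\<close>.\<close>
    using assms by (subst congr_euler_sum[OF _ _ _ exp_section_4_tanh_fps(2), where i = "4 * n - 2"]) auto
qed auto

lemma riemann_zeta_4:
  assumes "n \<ge> 1"
  shows "riemann_zeta (of_nat (4 * n)) = complex_of_real
    ((-1) ^ (n + 1) * (sqrt 2 * pi) ^ (4 * n) / (4 * fact (4 * n + 1)) *
      (\<Sum>m = 0..n. real ((4 * n + 1) choose (4 * m)) * congr_euler 4 2 (4 * m)))"
proof (rule of_real_solve_sign)
  have 2: "4 * n = 2 * (2 * n)" "(- 1) ^ (2 * n) = (1 :: complex)" "2 * n > 0"
    using assms by auto
  have "fps_nth (coth_fps (1 + \<i>) + coth_fps (1 - \<i>)) (4 * n) =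
      - 2 * riemann_zeta (of_nat (4 * n)) * ((1 + \<i>) ^ (4 * n) + (1 - \<i>) ^ (4 * n)) / of_real ((2 * pi) ^ (4 * n))"
    unfolding fps_add_nth 2(1) fps_nth_coth_fps_even[OF 2(3)] 2(2) by (simp add: algebra_simps add_divide_distrib diff_divide_distrib)
  also have "\<dots> = - of_real 4 * (- 1) ^ n * riemann_zeta (of_nat (4 * n)) / of_real ((sqrt 2 * pi) ^ (4 * n))"
  proof -
    have "(2 * pi) ^ (4 * n) = 4 ^ n * (sqrt 2 * pi) ^ (4 * n)"
      by (simp only: two_pi_power sqrt_2_powers)
    then show ?thesis
      unfolding one_plus_i_powers(1) by simp
  qed
  finally show "complex_of_real (\<Sum>m = 0..n. real ((4 * n + 1) choose (4 * m)) * congr_euler 4 2 (4 * m)) =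
      fact (4 * n + 1) * (- of_real 4 * (- 1) ^ n * riemann_zeta (of_nat (4 * n)) / of_real ((sqrt 2 * pi) ^ (4 * n)))"
    \<comment> \<open>\<open>j = 2\<close>, \<open>r = 1\<close> and \<open>k = 4 * n + 1\<close>,
      so the sum runs up to \<open>n\<close>.\<close>
    by (subst congr_euler_sum[OF _ _ _ exp_section_4_coth_fps(1), where i = "4 * n"]) auto
qed auto

lemma riemann_zeta_4_minus_2:
  assumes "n \<ge> 1"
  shows "riemann_zeta (of_nat (4 * n - 2)) = complex_of_real
    ((-1) ^ (n + 1) * (sqrt 2 * pi) ^ (4 * n - 2) / (4 * fact (4 * n - 1)) *
      (\<Sum>m = 0..n - 1. real ((4 * n - 1) choose (4 * m)) * congr_euler 4 2 (4 * m)))"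
proof (rule of_real_solve_sign)
  have 2: "4 * n - 2 = 2 * (2 * n - 1)" "(- 1) ^ (2 * n - 1) = (- 1 :: complex)" "2 * n - 1 > 0"
    using assms by (auto simp: power_minus_odd)
  have "fps_nth (fps_const \<i> * (coth_fps (1 - \<i>) - coth_fps (1 + \<i>))) (4 * n - 2) =
      2 * riemann_zeta (of_nat (4 * n - 2)) * (\<i> * ((1 - \<i>) ^ (4 * n - 2) - (1 + \<i>) ^ (4 * n - 2)))
        / of_real ((2 * pi) ^ (4 * n - 2))"
    unfolding fps_mult_left_const_nth fps_sub_nth 2(1) fps_nth_coth_fps_even[OF 2(3)] 2(2)
    by (simp add: field_simps)
  also have "\<dots> = - of_real 4 * (- 1) ^ n * riemann_zeta (of_nat (4 * n - 2)) / of_real ((sqrt 2 * pi) ^ (4 * n - 2))"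
  proof -
    have *: "(2 * pi) ^ (4 * n - 2) = 4 ^ n / 2 * (sqrt 2 * pi) ^ (4 * n - 2)"
      by (simp only: two_pi_power sqrt_2_powers(2)[OF assms])
    show ?thesis
      unfolding one_plus_i_powers(2)[OF assms] * by simp
  qed
  finally show "complex_of_real (\<Sum>m = 0..n - 1. real ((4 * n - 1) choose (4 * m)) * congr_euler 4 2 (4 * m)) =
      fact (4 * n - 1) * (- of_real 4 * (- 1) ^ n * riemann_zeta (of_nat (4 * n - 2)) / of_real ((sqrt 2 * pi) ^ (4 * n - 2)))"
    \<comment> \<open>\<open>j = 2\<close>, \<open>r = 3\<close> and
      \<open>k = 4 * n - 1 = 4 * (n - 1) + 3\<close>.\<close>
    using assms by (subst congr_euler_sum[OF _ _ _ exp_section_4_coth_fps(2), where i = "4 * n - 2"]) auto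
qed auto

text \<open>The witness is \<open>exp (2 * pi * \<i> / 3)\<close> in Cartesian form.\<close>

lemma primitive_cube_root_of_unity_exists: "\<exists>z::complex. z\<^sup>2 + z + 1 = 0"
  by (rule exI[of _ "Complex (- 1 / 2) (sqrt 3 / 2)"]) (simp add: complex_eq_iff power2_eq_square)

lemma riemann_zeta_6:
  assumes "n \<ge> 1"
  shows "riemann_zeta (of_nat (6 * n)) = complex_of_real
    ((-1) ^ (n + 1) * (2 * pi) ^ (6 * n) / (6 * fact (6 * n + 2)) *
      (\<Sum>m = 0..n. real ((6 * n + 2) choose (6 * m)) * congr_euler 6 3 (6 * m)))"
proof (rule of_real_solve_sign)
  obtain z :: complex where z: "z\<^sup>2 + z + 1 = 0"
    using primitive_cube_root_of_unity_exists by blast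
  then have "z ^ 6 = 1" by algebra
  then have *: "z ^ (6 * n) = 1"
    by (simp add: power_mult)
  have "(z\<^sup>2) ^ (6 * n) = (z ^ (6 * n))\<^sup>2"
    by (simp only: power_mult [symmetric] mult.commute)
  then have **: "(z\<^sup>2) ^ (6 * n) = 1"
    using * by simp
  have e: "6 * n = 2 * (3 * n)" "3 * n > 0"
    using assms by auto
  have "fps_nth (coth_fps 1 + coth_fps z + coth_fps (z\<^sup>2)) (6 * n) =
      - 2 * (- 1) ^ (3 * n) * riemann_zeta (of_nat (6 * n)) * (1 + z ^ (6 * n) + (z\<^sup>2) ^ (6 * n)) / of_real ((2 * pi) ^ (6 * n))"
    unfolding fps_add_nth e(1) fps_nth_coth_fps_even[OF e(2)] by (simp add: algebra_simps add_divide_distrib diff_divide_distrib)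
  also have "\<dots> = - of_real 6 * (- 1) ^ n * riemann_zeta (of_nat (6 * n)) / of_real ((2 * pi) ^ (6 * n))"
    unfolding * ** by (simp add: power_mult)
  finally show "complex_of_real (\<Sum>m = 0..n. real ((6 * n + 2) choose (6 * m)) * congr_euler 6 3 (6 * m)) =
      fact (6 * n + 2) * (- of_real 6 * (- 1) ^ n * riemann_zeta (of_nat (6 * n)) / of_real ((2 * pi) ^ (6 * n)))"
    \<comment> \<open>\<open>j = 3\<close>, \<open>r = 2\<close> and \<open>k = 6 * n + 2\<close>,
      so the sum runs up to \<open>n\<close>.\<close>
    by (subst congr_euler_sum[OF _ _ _ exp_section_6_coth_fps(1)[OF z], where i = "6 * n"]) auto
qed auto

lemma riemann_zeta_6_minus_4:
  assumes "n \<ge> 1"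
  shows "riemann_zeta (of_nat (6 * n - 4)) = complex_of_real
    ((-1) ^ (n + 1) * (2 * pi) ^ (6 * n - 4) / (6 * fact (6 * n - 2)) *
      (\<Sum>m = 0..n - 1. real ((6 * n - 2) choose (6 * m)) * congr_euler 6 3 (6 * m)))"
proof (rule of_real_solve_sign)
  obtain z :: complex where z: "z\<^sup>2 + z + 1 = 0"
    using primitive_cube_root_of_unity_exists by blast
  then have z3: "z ^ 3 = 1" by algebra
  have e: "6 * n - 4 = 2 * (3 * n - 2)" "3 * n - 2 > 0" using assms by auto
  \<comment> \<open>The weight \<open>z\<close> raises the exponent to \<open>6 * n - 3\<close>, a
    multiple of 3, so all three weighted powers are 1.\<close>
  have "Suc (6 * n - 4) = 3 * (2 * n - 1)"
    using assms by auto
  then have "z * z ^ (6 * n - 4) = z ^ (3 * (2 * n - 1))"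
    by (metis power_Suc)
  then have *: "z * z ^ (6 * n - 4) = 1"
    by (simp add: power_mult z3)
  have "z\<^sup>2 * (z\<^sup>2) ^ (6 * n - 4) = (z * z ^ (6 * n - 4))\<^sup>2"
    by (simp only: power_mult_distrib power_mult [symmetric] mult.commute)
  then have **: "z\<^sup>2 * (z\<^sup>2) ^ (6 * n - 4) = 1"
    using * by simp
  have "(- 1) ^ (3 * n - 2) = ((- 1) ^ n :: complex)"
    using assms by (cases "even n") (auto simp: even_diff_nat)
  moreover have "fps_nth (coth_fps 1 + fps_const z * coth_fps z + fps_const (z\<^sup>2) * coth_fps (z\<^sup>2)) (6 * n - 4) =
      - 2 * (- 1) ^ (3 * n - 2) * riemann_zeta (of_nat (6 * n - 4)) *
        (1 + z * z ^ (6 * n - 4) + z\<^sup>2 * (z\<^sup>2) ^ (6 * n - 4)) / of_real ((2 * pi) ^ (6 * n - 4))"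
    unfolding fps_add_nth fps_mult_left_const_nth e(1) fps_nth_coth_fps_even[OF e(2)]
    by (simp add: field_simps)
  ultimately have "fps_nth (coth_fps 1 + fps_const z * coth_fps z + fps_const (z\<^sup>2) * coth_fps (z\<^sup>2)) (6 * n - 4) =
      - of_real 6 * (- 1) ^ n * riemann_zeta (of_nat (6 * n - 4)) / of_real ((2 * pi) ^ (6 * n - 4))"
    unfolding * ** by simp
  then show "complex_of_real (\<Sum>m = 0..n - 1. real ((6 * n - 2) choose (6 * m)) * congr_euler 6 3 (6 * m)) =
      fact (6 * n - 2) * (- of_real 6 * (- 1) ^ n * riemann_zeta (of_nat (6 * n - 4)) / of_real ((2 * pi) ^ (6 * n - 4)))"
    \<comment> \<open>\<open>j = 3\<close>, \<open>r = 4\<close> and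
      \<open>k = 6 * n - 2 = 6 * (n - 1) + 4\<close>.\<close>
    using assms by (subst congr_euler_sum[OF _ _ _ exp_section_6_coth_fps(2)[OF z], where i = "6 * n - 4"]) auto
qed auto

text \<open>Division by the Euler factor at 2: its \<open>2 ^ m\<close> merges with
  \<open>pi / sqrt 2\<close>, since \<open>2 * (pi / sqrt 2) = sqrt 2 * pi\<close>, and
  \<open>2 ^ m - 1\<close> stays in the denominator.\<close>

lemma riemann_zeta_conv_dirichlet_lambda:
  assumes "m \<ge> 2" "dirichlet_lambda (of_nat m) = complex_of_real (s * (pi / sqrt 2) ^ m / (4 * k) * S)"
  shows "riemann_zeta (of_nat m) = complex_of_real (s * (sqrt 2 * pi) ^ m / (4 * k * (2 ^ m - 1)) * S)"
proof -
  have "(2 :: real) ^ m > 1"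
    using assms(1) by (intro one_less_power) auto
  then have nz: "(2 :: real) ^ m - 1 \<noteq> 0" by simp
  then have nz': "1 - 1 / (2 :: complex) ^ m \<noteq> 0"
    by (metis (mono_tags, lifting) eq_iff_diff_eq_0 divide_eq_1_iff of_real_1 of_real_eq_iff of_real_numeral of_real_power)
  have "(sqrt 2 * pi) ^ m = (2 * (pi / sqrt 2)) ^ m"
    using real_div_sqrt[of 2] by (metis times_divide_eq_left times_divide_eq_right mult.commute zero_le_numeral)
  then have "(sqrt 2 * pi) ^ m = 2 ^ m * (pi / sqrt 2) ^ m"
    by (simp only: power_mult_distrib)
  \<comment> \<open>For \<open>k = 0\<close> both sides are 0, as division by zero gives 0;
    otherwise the fractions can be cleared.\<close>
  then have *: "(1 - 1 / 2 ^ m) * (s * (sqrt 2 * pi) ^ m / (4 * k * (2 ^ m - 1)) * S) = s * (pi / sqrt 2) ^ m / (4 * k) * S"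
    using nz by (cases "k = 0") (simp_all add: divide_simps mult_ac del: power_divide)
  have "(1 - 1 / 2 ^ m) * riemann_zeta (of_nat m) =
      (1 - 1 / 2 ^ m) * complex_of_real (s * (sqrt 2 * pi) ^ m / (4 * k * (2 ^ m - 1)) * S)"
  proof -
    have "(1 - 1 / 2 ^ m) * complex_of_real x = complex_of_real ((1 - 1 / 2 ^ m) * x)" for x
      by simp
    then show ?thesis
      using * assms(2) unfolding dirichlet_lambda_of_nat[OF assms(1)] by (simp only:)
  qed
  then show ?thesis
    by (rule mult_left_cancel[OF nz', THEN iffD1])
qed

theorem theorem1p3:
  fixes n :: nat
  assumes "n \<ge> 1"
  shows "dirichlet_lambda (of_nat (4 * n)) = complex_of_real
           ((-1) ^ (n + 1) * (pi / sqrt 2) ^ (4 * n) / (4 * fact (4 * n - 1)) *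
             (\<Sum>m = 0..n - 1. real ((4 * n - 1) choose (4 * m)) * congr_euler 4 0 (4 * m))) \<and>
    dirichlet_lambda (of_nat (4 * n - 2)) = complex_of_real
           ((-1) ^ (n + 1) * (pi / sqrt 2) ^ (4 * n - 2) / (4 * fact (4 * n - 3)) *
             (\<Sum>m = 0..n - 1. real ((4 * n - 3) choose (4 * m)) * congr_euler 4 0 (4 * m))) \<and>
    riemann_zeta (of_nat (4 * n)) = complex_of_real
           ((-1) ^ (n + 1) * (sqrt 2 * pi) ^ (4 * n) / (4 * fact (4 * n - 1) * (2 ^ (4 * n) - 1)) *
             (\<Sum>m = 0..n - 1. real ((4 * n - 1) choose (4 * m)) * congr_euler 4 0 (4 * m))) \<and>
    riemann_zeta (of_nat (4 * n - 2)) = complex_of_real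
           ((-1) ^ (n + 1) * (sqrt 2 * pi) ^ (4 * n - 2) / (4 * fact (4 * n - 3) * (2 ^ (4 * n - 2) - 1)) *
             (\<Sum>m = 0..n - 1. real ((4 * n - 3) choose (4 * m)) * congr_euler 4 0 (4 * m))) \<and>
    riemann_zeta (of_nat (4 * n)) = complex_of_real
           ((-1) ^ (n + 1) * (sqrt 2 * pi) ^ (4 * n) / (4 * fact (4 * n + 1)) *
             (\<Sum>m = 0..n. real ((4 * n + 1) choose (4 * m)) * congr_euler 4 2 (4 * m))) \<and>
    riemann_zeta (of_nat (4 * n - 2)) = complex_of_real
           ((-1) ^ (n + 1) * (sqrt 2 * pi) ^ (4 * n - 2) / (4 * fact (4 * n - 1)) *
             (\<Sum>m = 0..n - 1. real ((4 * n - 1) choose (4 * m)) * congr_euler 4 2 (4 * m))) \<and>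
    riemann_zeta (of_nat (6 * n)) = complex_of_real
           ((-1) ^ (n + 1) * (2 * pi) ^ (6 * n) / (6 * fact (6 * n + 2)) *
             (\<Sum>m = 0..n. real ((6 * n + 2) choose (6 * m)) * congr_euler 6 3 (6 * m))) \<and>
    riemann_zeta (of_nat (6 * n - 4)) = complex_of_real
           ((-1) ^ (n + 1) * (2 * pi) ^ (6 * n - 4) / (6 * fact (6 * n - 2)) *
             (\<Sum>m = 0..n - 1. real ((6 * n - 2) choose (6 * m)) * congr_euler 6 3 (6 * m)))"
proof -
  have m: "2 \<le> 4 * n" "2 \<le> 4 * n - 2"
    using assms by auto
  show ?thesis
    using dirichlet_lambda_4[OF assms] dirichlet_lambda_4_minus_2[OF assms]
      riemann_zeta_conv_dirichlet_lambda[OF m(1) dirichlet_lambda_4[OF assms]]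
      riemann_zeta_conv_dirichlet_lambda[OF m(2) dirichlet_lambda_4_minus_2[OF assms]]
      riemann_zeta_4[OF assms] riemann_zeta_4_minus_2[OF assms]
      riemann_zeta_6[OF assms] riemann_zeta_6_minus_4[OF assms]
    by (intro conjI)
qed

end
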